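(* If a multiplicative function $g : \mathbb{N} \to \mathbb{C}$ satisfies \[ g(a^3 + b^3) = g(a)^3 + g(b)^3 \] for all $a, b \in \mathbb{N}$, then $g(n) = n$ for every $n \in \mathbb{N}$ except possibly those $n$ with $3 \mid n$ and $3^2 \nmid n$. Besides, \[ g(3) \in \left\{ 3,\ \frac{3(-1+\sqrt{-3})}{2},\ \frac{3(-1-\sqrt{-3})}{2} \right\}. \]
   Context: $\mathbb{N}$ denotes the set of positive integers. A function $g : \mathbb{N} \to \mathbb{C}$ is multiplicative if $g(1) = 1$ and $g(mn) = g(m) g(n)$ whenever $\gcd(m,n) = 1$. *)

theory Defs
  imports Complex_Main
begin

(* Arithmetic functions on the positive integers are represented by functions on
   nat; the value at 0 is unconstrained. *)
definition multiplicative :: "(nat \<Rightarrow> complex) \<Rightarrow> bool" where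
  "multiplicative g \<longleftrightarrow>
     g 1 = 1 \<and> (\<forall>m n. m > 0 \<longrightarrow> n > 0 \<longrightarrow> coprime m n \<longrightarrow> g (m * n) = g m * g n)"

end

theory Submission
  imports Defs "HOL-Computational_Algebra.Primes"
begin

text \<open>
  Taxicab coincidences such as \<open>1729 = 1 + 12\<^sup>3 = 9\<^sup>3 + 10\<^sup>3\<close> give enough polynomial relations
  between \<open>g 3\<close>, \<open>g 4\<close>, \<open>g 5\<close> and \<open>g 7\<close> to force \<open>g(3)\<^sup>3 = 27\<close> and \<open>g 7 = 7\<close>. The rest is strong
  induction: if \<open>N = a\<^sup>2 - a b + b\<^sup>2\<close> then also \<open>N = a\<^sup>2 - a d + d\<^sup>2\<close> with \<open>d = a - b\<close>, so both
  \<open>(a + b) N\<close> and \<open>(2 a - b) N\<close> are sums of two cubes. If \<open>g\<close> fixes one of \<open>a + b\<close> and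
  \<open>2 a - b\<close>, then by multiplicativity it fixes \<open>N\<close>, and hence the other. Every \<open>n\<close> prime to \<open>6\<close>
  and every power of \<open>3\<close> can be compared in this way with a smaller number, while powers of \<open>2\<close> come
  from \<open>1 + 1 = 2\<close>, \<open>1 + 3\<^sup>3 = 4 \<cdot> 7\<close> and \<open>1 + 2\<^sup>3 = 9\<close> scaled by \<open>8\<^sup>i\<close>.
\<close>

section \<open>Algebra over the complex numbers\<close>

text \<open>To be used with \<open>x\<close>, \<open>C\<close>, \<open>D\<close> the cubes of
  \<open>g 3\<close>, \<open>g 5\<close>, \<open>g 4\<close> and \<open>e = g 7\<close>. Eliminating
  \<open>C\<close>, \<open>D\<close>, \<open>e\<close> leaves a cubic and a quintic in
  \<open>x\<close> whose only common root is 27.\<close>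

lemma taxicab_system:
  fixes x C D e :: complex
  assumes "x * C = 3375" "D * x = 728 + 8 * C" "729 * D + x = x ^ 3 + 8 * (x * C)"
    "18 * e = 1 + C" "x * e = D + C"
  shows "x = 27"
proof (rule ccontr)
  assume "x \<noteq> 27"
  have "x ^ 2 * e = D * x + x * C"
    using assms(5) by algebra
  then have "x ^ 2 * e = 4103 + 8 * C"
    by (simp add: assms(1,2))
  then have "x ^ 2 * (1 + C) = 18 * (4103 + 8 * C)"
    using assms(4) by algebra
  \<comment> \<open>Multiplying by \<open>x\<close> turns every \<open>C\<close> into 3375; the
    resulting cubic splits off the expected root.\<close>
  then have "(x - 27) * (x ^ 2 + 3402 * x + 18000) = 0"
    using assms(1) by algebra
  with \<open>x \<noteq> 27\<close> have "x ^ 2 + (3402 * x + 18000) = 0"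
    by (simp only: mult_eq_0_iff right_minus_eq add.assoc simp_thms)
  moreover have "(x ^ 3 + 27000) * x ^ 2 = 530712 * x + 19683000 + x ^ 3"
  proof -
    have "(729 * D + x) * x ^ 2 = 729 * x * (D * x) + x ^ 3"
      by algebra
    also have "\<dots> = 530712 * x + 5832 * (x * C) + x ^ 3"
      unfolding assms(2) by algebra
    finally show ?thesis
      using assms(1,3) by simp
  qed
  \<comment> \<open>The quadratic and the quintic are coprime polynomials.\<close>
  ultimately show False
    by algebra
qed

lemma cube_eq_27:
  fixes z w :: complex
  assumes "z ^ 3 = 27" "w * w = - 3"
  shows "z \<in> {3, 3 * (- 1 + w) / 2, 3 * (- 1 - w) / 2}"
proof -
  have "(z - 3) * ((z - 3 * (- 1 + w) / 2) * (z - 3 * (- 1 - w) / 2))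
    = z ^ 3 - 27 - (9 / 4) * (z - 3) * (w * w + 3)"
    by (simp add: field_simps power3_eq_cube)
  then have "(z - 3) * ((z - 3 * (- 1 + w) / 2) * (z - 3 * (- 1 - w) / 2)) = 0"
    by (simp add: assms)
  then show ?thesis
    by (simp only: mult_eq_0_iff right_minus_eq insert_iff empty_iff simp_thms)
qed

text \<open>Meant for \<open>3 * (a^2 - a*b + b^2) = (a + b) * (2*a - b) + (a - 2*b)^2\<close>: the
  choices of \<open>a\<close> and \<open>b\<close> below make the remainder \<open>c\<close> equal
  to 1 or 4, after cancelling 9 in the case of powers of 3.\<close>

lemma coprime_if_linear:
  fixes s N :: nat
  assumes "k * N = s * t + c" "coprime s c"
  shows "coprime s N"
proof (rule coprimeI)
  fix d assume d: "d dvd s" "d dvd N"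
  then have "d dvd s * t + c"
    by (metis assms(1) dvd_mult)
  with d have "d dvd c"
    by (simp add: dvd_add_right_iff)
  with d show "is_unit d"
    using coprime_common_divisor[OF assms(2)] by blast
qed

lemma coprime_nine: "\<not> 3 dvd n \<Longrightarrow> coprime 9 (n :: nat)"
  using coprime_power_left_iff[of 3 2 n] prime_imp_coprime[of 3 n] by simp

section \<open>Values at small arguments\<close>

locale cube_additive =
  fixes g :: "nat \<Rightarrow> complex"
  assumes multiplicative: "multiplicative g"
    and cubes: "\<And>a b :: nat. a > 0 \<Longrightarrow> b > 0 \<Longrightarrow> g (a ^ 3 + b ^ 3) = g a ^ 3 + g b ^ 3"
begin

lemma one [simp]: "g 1 = 1" "g (Suc 0) = 1"
  using multiplicative by (auto simp: multiplicative_def)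

lemma mult: "m > 0 \<Longrightarrow> n > 0 \<Longrightarrow> coprime m n \<Longrightarrow> g (m * n) = g m * g n"
  using multiplicative by (auto simp: multiplicative_def)

lemma two: "g 2 = 2"
  using cubes[of 1 1] by (simp add: numeral_2_eq_2)

lemma nine: "g 9 = 9"
  using cubes[of 1 2] by (simp add: two)

lemma sixteen: "g 16 = 16"
  using cubes[of 2 2] by (simp add: two)

lemma twentyseven: "g 27 = g 3 ^ 3"
proof -
  have "g (2 * 27) = g 2 * g 27"
    by (rule mult) (auto simp: coprime_commute)
  then show ?thesis
    using cubes[of 3 3] by (simp add: two)
qed

lemma coprime_small:
  "coprime (4::nat) 7" "coprime (5::nat) 7" "coprime (2::nat) 9" "coprime (18::nat) 7"
  "coprime (27::nat) 7" "coprime (4::nat) 3" "coprime (2::nat) 5" "coprime (4::nat) 9"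
  "coprime (3::nat) 5" "coprime (2::nat) 15" "coprime (2::nat) 7" "coprime (3::nat) 2"
  by (simp_all add: coprime_iff_gcd_eq_1 gcd_nat.simps)

lemma three_seven: "g 3 ^ 3 = 27" "g 7 = 7"
proof -
  note m = mult[OF _ _ coprime_small(1)] mult[OF _ _ coprime_small(2)] mult[OF _ _ coprime_small(3)]
    mult[OF _ _ coprime_small(4)] mult[OF _ _ coprime_small(5)] mult[OF _ _ coprime_small(6)]
    mult[OF _ _ coprime_small(7)] mult[OF _ _ coprime_small(8)] mult[OF _ _ coprime_small(9)]
    mult[OF _ _ coprime_small(10)]
  note m = m[simplified]
  \<comment> \<open>From \<open>126 = 18 * 7\<close>; the next relation comes from
    \<open>189 = 27 * 7\<close>.\<close>
  have "18 * g 7 = 1 + g 5 ^ 3"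
    using cubes[of 1 5] by (simp add: m two nine)
  moreover have "g 3 ^ 3 * g 7 = g 4 ^ 3 + g 5 ^ 3"
    using cubes[of 4 5] by (simp add: m twentyseven)
  \<comment> \<open>Both sums of cubes equal 4104.\<close>
  moreover have "g 3 ^ 3 * g 5 ^ 3 = 3375"
    using cubes[of 2 16] cubes[of 9 15]
    by (simp add: m two nine sixteen power_mult_distrib algebra_simps)
  moreover have "g 4 ^ 3 * g 3 ^ 3 = 728 + 8 * g 5 ^ 3"
    using cubes[of 1 12] cubes[of 9 10]
    by (simp add: m two nine power_mult_distrib algebra_simps)
  \<comment> \<open>This is 1729 scaled by 27. It is a new relation because 36 and 27 bring in
    \<open>g 9\<close> and \<open>g 27\<close> in place of \<open>g 3\<close> and
    \<open>g 9\<close>.\<close>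
  moreover have "729 * g 4 ^ 3 + g 3 ^ 3 = (g 3 ^ 3) ^ 3 + 8 * (g 3 ^ 3 * g 5 ^ 3)"
    using cubes[of 3 36] cubes[of 27 30]
    by (simp add: m two nine twentyseven power_mult_distrib algebra_simps)
  ultimately show x: "g 3 ^ 3 = 27"
    using taxicab_system by blast
  with \<open>g 3 ^ 3 * g 5 ^ 3 = 3375\<close> \<open>18 * g 7 = 1 + g 5 ^ 3\<close> show "g 7 = 7"
    by simp
qed

section \<open>Induction invariant and its transfer\<close>

text \<open>At numbers divisible by 3 but not by 9, \<open>g\<close> may be off by a cube root of
  unity. The functional equation sees \<open>a\<close> and \<open>b\<close> only through cubes, so
  such numbers still serve as summands.\<close>

definition good :: "nat \<Rightarrow> bool" where
  "good n \<longleftrightarrow> g n ^ 3 = of_nat n ^ 3 \<and> (\<not> 3 dvd n \<or> 9 dvd n \<longrightarrow> g n = of_nat n)"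

lemma goodI: "g n = of_nat n \<Longrightarrow> good n"
  by (simp add: good_def)

lemma good_cube: "good n \<Longrightarrow> g n ^ 3 = of_nat n ^ 3"
  by (simp add: good_def)

lemma good_eq: "good n \<Longrightarrow> \<not> 3 dvd n \<or> 9 dvd n \<Longrightarrow> g n = of_nat n"
  by (auto simp: good_def)

lemma good_cofactor:
  assumes eq: "s * N = a ^ 3 + b ^ 3" and cop: "coprime s N"
    and pos: "s > 0" "N > 0" "a > 0" "b > 0"
    and good: "good a" "good b" and N: "g N = of_nat N"
  shows "g s = of_nat s"
proof -
  have "g s * g N = g (a ^ 3 + b ^ 3)"
    using eq cop pos by (simp flip: mult)
  also have "\<dots> = of_nat (s * N)"
    unfolding eq using pos good by (simp add: cubes good_cube)
  finally show ?thesis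
    using N pos by simp
qed

text \<open>The common cofactor \<open>N\<close> carries information from \<open>t\<close> to
  \<open>s\<close>. Dividing by \<open>g t\<close> needs its exact value, hence the condition on
  \<open>t\<close>.\<close>

lemma good_transfer:
  assumes s: "s * N = a ^ 3 + b ^ 3" "coprime s N"
    and t: "t * N = a ^ 3 + d ^ 3" "coprime t N"
    and pos: "s > 0" "t > 0" "N > 0" "a > 0" "b > 0" "d > 0"
    and good: "good a" "good b" "good d" "good t" and t3: "\<not> 3 dvd t \<or> 9 dvd t"
  shows "good s"
proof -
  have "N * t = a ^ 3 + d ^ 3" "coprime N t"
    using t by (simp_all add: mult.commute coprime_commute)
  then have "g N = of_nat N"
    using pos good t3 by (intro good_cofactor[of N t a d]) (auto intro: good_eq)
  then show ?thesis
    using s pos good by (intro goodI) (rule good_cofactor[of s N a b])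
qed

lemma good_mult:
  assumes "good m" "good n" "m > 0" "n > 0" "coprime m n"
  shows "good (m * n)"
proof -
  have g: "g (m * n) = g m * g n"
    using assms by (intro mult)
  have "g (m * n) = of_nat (m * n)" if *: "\<not> 3 dvd m * n \<or> 9 dvd m * n"
  proof -
    \<comment> \<open>All factors 3 of the product lie in one of \<open>m\<close> and
      \<open>n\<close>, so an exceptional factor would make the product exceptional.\<close>
    have "\<not> (3 dvd m \<and> 3 dvd n)"
      using \<open>coprime m n\<close> by (auto simp: coprime_def)
    then have "3 dvd m \<Longrightarrow> coprime 9 n" "3 dvd n \<Longrightarrow> coprime 9 m"
      by (auto intro: coprime_nine)
    then have "\<not> 3 dvd m \<or> 9 dvd m" "\<not> 3 dvd n \<or> 9 dvd n"
      using * by (auto simp: coprime_dvd_mult_left_iff coprime_dvd_mult_right_iff)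
    then show ?thesis
      using assms(1,2) by (simp add: g good_eq)
  qed
  moreover have "g (m * n) ^ 3 = of_nat (m * n) ^ 3"
    using assms(1,2) by (simp add: g good_cube power_mult_distrib)
  ultimately show ?thesis
    unfolding good_def by blast
qed

section \<open>Comparison with smaller numbers\<close>

text \<open>With \<open>a = 2*m + 1\<close>, \<open>b = m + 1\<close>, \<open>d = m\<close>, the
  number is compared with its predecessor \<open>3*m + 1\<close>, which is prime to 3. Positivity of
  \<open>d\<close> requires \<open>m > 0\<close>.\<close>

lemma good_mod_3:
  assumes "m > 0" and IH: "\<And>k. 0 < k \<Longrightarrow> k < 3 * m + 2 \<Longrightarrow> good k"
  shows "good (3 * m + 2)"
proof -
  let ?N = "3 * m ^ 2 + 3 * m + 1"
  have N: "3 * ?N = (3 * m + 2) * (3 * m + 1) + 1" "3 * ?N = (3 * m + 1) * (3 * m + 2) + 1"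
    by (simp_all add: algebra_simps power2_eq_square)
  have c: "coprime (3 * m + 2) ?N" "coprime (3 * m + 1) ?N"
    by (rule coprime_if_linear[OF N(1)] coprime_if_linear[OF N(2)], simp)+
  have "(3 * m + 2) * ?N = (2 * m + 1) ^ 3 + (m + 1) ^ 3"
    "(3 * m + 1) * ?N = (2 * m + 1) ^ 3 + m ^ 3"
    by (simp_all add: algebra_simps power2_eq_square power3_eq_cube)
  moreover have "\<not> 3 dvd 3 * m + 1" by presburger
  ultimately show ?thesis
    using c by (intro good_transfer[of "3 * m + 2" ?N "2 * m + 1" "m + 1" "3 * m + 1" m] IH)
      (use \<open>m > 0\<close> in simp_all)
qed

text \<open>With \<open>a = 4*j + 4\<close>, \<open>b = 2*j + 3\<close>, \<open>d = 2*j + 1\<close>,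
  the comparison is with \<open>6*j + 5\<close>; both numbers are odd, so the remainder 4 is
  harmless.\<close>

lemma good_mod_6:
  assumes IH: "\<And>k. 0 < k \<Longrightarrow> k < 6 * j + 7 \<Longrightarrow> good k"
  shows "good (6 * j + 7)"
proof -
  let ?N = "12 * (j + 1) ^ 2 + 1"
  have N: "3 * ?N = (6 * j + 7) * (6 * j + 5) + 2 ^ 2" "3 * ?N = (6 * j + 5) * (6 * j + 7) + 2 ^ 2"
    by (simp_all add: algebra_simps power2_eq_square)
  have "coprime (6 * j + 7) (2 ^ 2)" "coprime (6 * j + 5) (2 ^ 2)"
    by (simp_all only: coprime_power_right_iff coprime_right_2_iff_odd) simp_all
  then have c: "coprime (6 * j + 7) ?N" "coprime (6 * j + 5) ?N"
    using N coprime_if_linear by blast+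
  have "(6 * j + 7) * ?N = (4 * j + 4) ^ 3 + (2 * j + 3) ^ 3"
    "(6 * j + 5) * ?N = (4 * j + 4) ^ 3 + (2 * j + 1) ^ 3"
    by (simp_all add: algebra_simps power2_eq_square power3_eq_cube)
  moreover have "\<not> 3 dvd 6 * j + 5" by presburger
  ultimately show ?thesis
    using c by (intro good_transfer[of "6 * j + 7" ?N "4 * j + 4" "2 * j + 3" "6 * j + 5" "2 * j + 1"] IH)
      simp_all
qed

text \<open>For \<open>n \<ge> 3\<close> take \<open>a = 2*w + 3\<close>, \<open>b = w + 3\<close>,
  \<open>d = w\<close>. Then \<open>a^2 - a*b + b^2\<close> is 3 times \<open>?N\<close>; moving
  that 3 to the linear factors gives \<open>9 * (w + 2)\<close>, which is the power, and
  \<open>9 * (w + 1)\<close>, where 9 guarantees an exact value.\<close>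

lemma good_power_3:
  assumes IH: "\<And>k. 0 < k \<Longrightarrow> k < (3::nat) ^ n \<Longrightarrow> good k"
  shows "good (3 ^ n)"
proof -
  consider "n = 0" | "n = 1" | "n = 2" | i where "n = i + 3"
    by (metis One_nat_def Suc_1 add.commute add_Suc_right add_cancel_right_left numeral_3_eq_3 old.nat.exhaust)
  then show ?thesis
  proof cases
    case 1
    then show ?thesis by (simp add: goodI)
  next
    case 2
    then show ?thesis by (simp add: good_def three_seven)
  next
    case 3
    then show ?thesis by (simp add: goodI nine)
  next
    case (4 i)
    \<comment> \<open>The predecessor \<open>v\<close> expresses \<open>w = 3 ^ (n - 2) - 2\<close>
      without subtraction and shows it to be 1 modulo 3.\<close>
    obtain v where v: "3 ^ i = Suc v"
      by (metis not0_implies_Suc power_eq_0_iff zero_neq_numeral)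
    define w where "w = 3 * v + 1"
    have n: "3 ^ n = 9 * (w + 2)" and "w > 0"
      by (simp_all add: 4 w_def power_add v)
    let ?N = "w ^ 2 + 3 * w + 3"
    have N: "?N = (w + 2) * (w + 1) + 1" "?N = (w + 1) * (w + 2) + 1"
      by (simp_all add: algebra_simps power2_eq_square)
    have "coprime (w + 2) ?N" "coprime (w + 1) ?N"
      by (rule coprime_if_linear[of 1, unfolded mult_1, OF N(1)]
          coprime_if_linear[of 1, unfolded mult_1, OF N(2)], simp)+
    moreover have "coprime 9 ?N"
    proof -
      have "?N = 3 * (3 * v ^ 2 + 5 * v + 2) + 1"
        by (simp add: w_def algebra_simps power2_eq_square)
      then have "\<not> 3 dvd ?N" by presburger
      then show ?thesis by (rule coprime_nine)
    qed
    ultimately have c: "coprime (9 * (w + 2)) ?N" "coprime (9 * (w + 1)) ?N"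
      by (simp_all only: coprime_mult_left_iff)
    have IH': "good k" if "0 < k" "k < 9 * (w + 2)" for k
      using IH that n by simp
    have "9 * (w + 2) * ?N = (2 * w + 3) ^ 3 + (w + 3) ^ 3"
      "9 * (w + 1) * ?N = (2 * w + 3) ^ 3 + w ^ 3"
      by (simp_all add: algebra_simps power2_eq_square power3_eq_cube)
    then show ?thesis
      unfolding n using c \<open>w > 0\<close>
      by (intro good_transfer[of "9 * (w + 2)" ?N "2 * w + 3" "w + 3" "9 * (w + 1)" w] IH') simp_all
  qed
qed

lemma good_power_2:
  assumes IH: "\<And>k. 0 < k \<Longrightarrow> k < (2::nat) ^ n \<Longrightarrow> good k"
  shows "good (2 ^ n)"
proof -
  have pow: "good (2 ^ k)" if "k < n" for k
    using that by (intro IH) auto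
  consider "n = 0" | i where "n = 3 * i + 3" | i where "n = 3 * i + 1" | i where "n = 3 * i + 2"
  proof -
    have "n = 0 \<or> (\<exists>i. n = 3 * i + 3) \<or> (\<exists>i. n = 3 * i + 1) \<or> (\<exists>i. n = 3 * i + 2)"
      by presburger
    then show ?thesis using that by blast
  qed
  then show ?thesis
  proof cases
    case 1
    then show ?thesis by (simp add: goodI)
  next
    case (2 i)
    have g: "good (2 ^ (i + 1))" "good (2 ^ (i + 2))"
      by (rule pow, simp add: 2)+
    have eq: "(2 ^ (i + 1)) ^ 3 * 9 = (2 ^ (i + 1)) ^ 3 + ((2 ^ (i + 2)) ^ 3 :: nat)"
      by (simp add: power_mult_distrib)
    have cop: "coprime ((2 ^ (i + 1)) ^ 3) (9::nat)"
      using coprime_small(3) by (simp only: coprime_power_left_iff simp_thms)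
    have "g ((2 ^ (i + 1)) ^ 3) = of_nat ((2 ^ (i + 1)) ^ 3)"
      by (rule good_cofactor[OF eq cop _ _ _ _ g]) (simp_all add: nine)
    moreover have "(2 ^ (i + 1)) ^ 3 = (2::nat) ^ n"
      unfolding 2 by (simp only: flip: power_mult) (simp add: algebra_simps)
    ultimately show ?thesis
      by (simp only: goodI)
  next
    case (3 i)
    have "good (2 ^ i)"
      by (rule pow) (simp add: 3)
    then have "g ((2 ^ i) ^ 3 + (2 ^ i) ^ 3) = of_nat ((2 ^ i) ^ 3 + (2 ^ i) ^ 3)"
      by (subst cubes) (auto simp: good_cube)
    moreover have "(2 ^ i) ^ 3 + (2 ^ i) ^ 3 = (2::nat) ^ n"
      unfolding 3 by (simp add: power_add mult.commute flip: power_mult)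
    ultimately show ?thesis
      by (simp only: goodI)
  next
    case (4 i)
    have i: "good (2 ^ i)"
      by (rule pow) (simp add: 4)
    moreover have "good 3"
      by (simp add: good_def three_seven)
    \<comment> \<open>Here \<open>g 3\<close> may differ from 3; only the cube of
      \<open>g (3 * 2 ^ i)\<close> enters.\<close>
    ultimately have g: "good (3 * 2 ^ i)"
      using coprime_small(12) by (intro good_mult) simp_all
    have eq: "4 * (2 ^ i) ^ 3 * 7 = (3 * 2 ^ i) ^ 3 + ((2 ^ i) ^ 3 :: nat)"
      by (simp add: power_mult_distrib)
    have cop: "coprime (4 * (2 ^ i) ^ 3) (7::nat)"
      using coprime_small by (simp only: coprime_mult_left_iff coprime_power_left_iff simp_thms)
    have "g (4 * (2 ^ i) ^ 3) = of_nat (4 * (2 ^ i) ^ 3)"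
      by (rule good_cofactor[OF eq cop _ _ _ _ g i]) (simp_all add: three_seven)
    moreover have "4 * (2 ^ i) ^ 3 = (2::nat) ^ n"
      unfolding 4 by (simp add: power_add mult.commute flip: power_mult)
    ultimately show ?thesis
      by (simp only: goodI)
  qed
qed

section \<open>Strong induction\<close>

lemma good: "n > 0 \<Longrightarrow> good n"
proof (induction n rule: less_induct)
  case (less n)
  \<comment> \<open>Splitting off the full power of \<open>p\<close> leaves two smaller coprime
    factors unless \<open>n\<close> is itself a power of \<open>p\<close>.\<close>
  have split_prime: "good n" if "prime p" "p dvd n" and pow: "\<And>k. n = p ^ k \<Longrightarrow> good n" for p
  proof -
    obtain k m where n: "n = p ^ k * m" "\<not> p dvd m"
      using less.prems \<open>prime p\<close> by (metis multiplicity_decompose' not_prime_unit less_numeral_extra(3))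
    then have "k > 0"
      using \<open>p dvd n\<close> by (cases k) auto
    have "m > 0" "p > 1"
      using n less.prems \<open>prime p\<close> prime_gt_1_nat by auto
    show ?thesis
    proof (cases "m = 1")
      case True
      then show ?thesis using n pow by simp
    next
      case False
      have "p ^ k > 1"
        using \<open>k > 0\<close> \<open>p > 1\<close> by (rule one_less_power[rotated])
      then have "good (p ^ k)" "good m"
        using n \<open>m > 0\<close> False prime_gt_0_nat[OF \<open>prime p\<close>] by (intro less.IH; simp)+
      moreover have "coprime (p ^ k) m"
        using n \<open>prime p\<close> by (simp add: prime_imp_coprime)
      ultimately show ?thesis
        unfolding n(1) using \<open>p ^ k > 1\<close> \<open>m > 0\<close> by (intro good_mult) linarith+
    qed
  qed
  \<comment> \<open>An \<open>n > 1\<close> prime to 6 is 2 modulo 3, with \<open>m > 0\<close>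
    since 2 is even, or 1 modulo 6 and so at least 7.\<close>
  consider "2 dvd n" | "3 dvd n" | "n = 1" | m where "m > 0" "n = 3 * m + 2" | j where "n = 6 * j + 7"
  proof -
    have "2 dvd n \<or> 3 dvd n \<or> n = 1 \<or> (\<exists>m>0. n = 3 * m + 2) \<or> (\<exists>j. n = 6 * j + 7)"
      by presburger
    then show ?thesis using that by blast
  qed
  then show ?case
  proof cases
    case 1
    then show ?thesis
      using split_prime[of 2] good_power_2 less.IH by auto
  next
    case 2
    then show ?thesis
      using split_prime[of 3] good_power_3 less.IH by auto
  next
    case 3
    then show ?thesis by (simp add: goodI)
  next
    case (4 m)
    then show ?thesis using good_mod_3 less.IH by simp
  next
    case (5 j)
    then show ?thesis using good_mod_6 less.IH by simp
  qed
qed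

end

theorem theorem6p1:
  fixes g :: "nat \<Rightarrow> complex"
  assumes "multiplicative g"
    and "\<And>a b :: nat. a > 0 \<Longrightarrow> b > 0 \<Longrightarrow> g (a ^ 3 + b ^ 3) = g a ^ 3 + g b ^ 3"
  shows "(\<forall>n::nat. n > 0 \<and> \<not> (3 dvd n \<and> \<not> 3 ^ 2 dvd n) \<longrightarrow> g n = of_nat n)
    \<and> g 3 \<in> {3, 3 * (- 1 + csqrt (- 3)) / 2, 3 * (- 1 - csqrt (- 3)) / 2}"
proof -
  interpret cube_additive g
    using assms by unfold_locales auto
  have "csqrt (- 3) * csqrt (- 3) = - 3"
    by (metis power2_csqrt power2_eq_square)
  then have "g 3 \<in> {3, 3 * (- 1 + csqrt (- 3)) / 2, 3 * (- 1 - csqrt (- 3)) / 2}"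
    by (rule cube_eq_27[OF three_seven(1)])
  moreover have "\<forall>n. n > 0 \<and> \<not> (3 dvd n \<and> \<not> 3 ^ 2 dvd n) \<longrightarrow> g n = of_nat n"
    using good good_eq by simp
  ultimately show ?thesis
    by blast
qed

end
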